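(* There exist infinitely many pairwise non-isomorphic flat left invariant affine structures on the Lie group $G=Aff(\mathbb{R})$ of affine transformations of the real line.
   Context: $Aff(\mathbb{R})=\mathbb{R}^*\times\mathbb{R}$ with product $(a,b)(c,d)=(ac,ad+b)$; its Lie algebra $\mathfrak{g}$ has a basis $e_1,e_2$ with $[e_1,e_2]=e_2$. A flat left invariant affine structure on $G$ is a flat, torsion free, left invariant linear connection $\nabla$. Such structures correspond bijectively, via $\nabla_{x^+}y^+=(x\cdot y)^+$ ($x^+$ the left invariant vector field determined by $x\in\mathfrak{g}$), to left symmetric products on $\mathfrak{g}$ compatible with the bracket, i.e. bilinear products with $(x,y,z)=(y,x,z)$, where $(x,y,z)=(x\cdot y)\cdot z-x\cdot(y\cdot z)$, and $x\cdot y-y\cdot x=[x,y]$. Two structures are isomorphic if the corresponding real left symmetric algebras are isomorphic as algebras. *)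

theory Defs
  imports "HOL-Analysis.Analysis" "HOL-Algebra.Group"
begin

section \<open>The Lie group of affine transformations of the real line\<close>

text \<open>The pair \<open>(a, b)\<close> stands for the map \<open>t \<mapsto> a t + b\<close>. As a manifold the group is an open
  subset of the plane, so both its tangent spaces and its Lie algebra (the tangent space at the
  identity \<open>(1, 0)\<close>) are \<open>real \<times> real\<close>.\<close>

definition Aff :: "(real \<times> real) monoid" where
  "Aff = \<lparr>carrier = {p. fst p \<noteq> 0},
          monoid.mult = (\<lambda>p q. (fst p * fst q, fst p * snd q + snd p)),
          one = (1, 0)\<rparr>"

lemma group_Aff: "group Aff"
proof (rule groupI)
  fix p assume p: "p \<in> carrier Aff"
  show "\<exists>q\<in>carrier Aff. q \<otimes>\<^bsub>Aff\<^esub> p = \<one>\<^bsub>Aff\<^esub>"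
    by (rule bexI[of _ "(1 / fst p, - snd p / fst p)"]) (use p in \<open>auto simp: Aff_def\<close>)
qed (auto simp: Aff_def algebra_simps)

section \<open>Smooth functions and smooth vector fields\<close>

primrec k_times_cont_diff_on ::
    "nat \<Rightarrow> 'a set \<Rightarrow> ('a::euclidean_space \<Rightarrow> 'b::real_normed_vector) \<Rightarrow> bool" where
  "k_times_cont_diff_on 0 S f \<longleftrightarrow> continuous_on S f"
| "k_times_cont_diff_on (Suc k) S f \<longleftrightarrow>
     (\<forall>p\<in>S. f differentiable (at p)) \<and>
     (\<forall>v. k_times_cont_diff_on k S (\<lambda>p. frechet_derivative f (at p) v))"

text \<open>Meant for open \<open>S\<close> only; the values of \<open>f\<close> outside \<open>S\<close> are then irrelevant.\<close>

definition smooth_on :: "'a set \<Rightarrow> ('a::euclidean_space \<Rightarrow> 'b::real_normed_vector) \<Rightarrow> bool" where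
  "smooth_on S f \<longleftrightarrow> (\<forall>k. k_times_cont_diff_on k S f)"

type_synonym vfield = "real \<times> real \<Rightarrow> real \<times> real"

text \<open>Vector fields on \<open>Aff\<close> are extended by zero outside the carrier, so that equality of
  functions is equality of vector fields.\<close>

definition on_Aff :: "vfield \<Rightarrow> vfield" where
  "on_Aff X = (\<lambda>p. if p \<in> carrier Aff then X p else 0)"

definition vector_fields :: "vfield set" where
  "vector_fields = {X. smooth_on (carrier Aff) X \<and> (\<forall>p. p \<notin> carrier Aff \<longrightarrow> X p = 0)}"

definition directional_deriv :: "vfield \<Rightarrow> (real \<times> real \<Rightarrow> real) \<Rightarrow> (real \<times> real \<Rightarrow> real)" where
  "directional_deriv X f = (\<lambda>p. frechet_derivative f (at p) (X p))"

definition lie_bracket :: "vfield \<Rightarrow> vfield \<Rightarrow> vfield" where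
  "lie_bracket X Y = on_Aff (\<lambda>p. frechet_derivative Y (at p) (X p)
                                - frechet_derivative X (at p) (Y p))"

definition left_translation :: "real \<times> real \<Rightarrow> real \<times> real \<Rightarrow> real \<times> real" where
  "left_translation g = (\<lambda>h. g \<otimes>\<^bsub>Aff\<^esub> h)"

text \<open>The push-forward of a vector field under left translation by \<open>g\<close>.\<close>

definition left_pushforward :: "real \<times> real \<Rightarrow> vfield \<Rightarrow> vfield" where
  "left_pushforward g X = on_Aff (\<lambda>p.
     let q = inv\<^bsub>Aff\<^esub> g \<otimes>\<^bsub>Aff\<^esub> p in frechet_derivative (left_translation g) (at q) (X q))"

text \<open>The left invariant vector field \<open>x\<^sup>+\<close> determined by the tangent vector \<open>x\<close> at the identity.\<close>

definition left_inv_field :: "real \<times> real \<Rightarrow> vfield" where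
  "left_inv_field x = on_Aff (\<lambda>p. frechet_derivative (left_translation p) (at \<one>\<^bsub>Aff\<^esub>) x)"

section \<open>Flat left invariant affine structures\<close>

text \<open>Connections are compared only through their action on \<^const>\<open>vector_fields\<close>; their values on
  other functions carry no meaning.\<close>

type_synonym connection = "vfield \<Rightarrow> vfield \<Rightarrow> vfield"

definition linear_connection :: "connection \<Rightarrow> bool" where
  "linear_connection D \<longleftrightarrow>
     (\<forall>X\<in>vector_fields. \<forall>Y\<in>vector_fields. D X Y \<in> vector_fields) \<and>
     (\<forall>X\<in>vector_fields. \<forall>X'\<in>vector_fields. \<forall>Y\<in>vector_fields.
        D (\<lambda>p. X p + X' p) Y = (\<lambda>p. D X Y p + D X' Y p)) \<and>
     (\<forall>X\<in>vector_fields. \<forall>Y\<in>vector_fields. \<forall>Y'\<in>vector_fields.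
        D X (\<lambda>p. Y p + Y' p) = (\<lambda>p. D X Y p + D X Y' p)) \<and>
     (\<forall>f. smooth_on (carrier Aff) f \<longrightarrow> (\<forall>X\<in>vector_fields. \<forall>Y\<in>vector_fields.
        D (\<lambda>p. f p *\<^sub>R X p) Y = (\<lambda>p. f p *\<^sub>R D X Y p))) \<and>
     (\<forall>f. smooth_on (carrier Aff) f \<longrightarrow> (\<forall>X\<in>vector_fields. \<forall>Y\<in>vector_fields.
        D X (\<lambda>p. f p *\<^sub>R Y p) =
          (\<lambda>p. directional_deriv X f p *\<^sub>R Y p + f p *\<^sub>R D X Y p)))"

definition torsion_free :: "connection \<Rightarrow> bool" where
  "torsion_free D \<longleftrightarrow> (\<forall>X\<in>vector_fields. \<forall>Y\<in>vector_fields.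
     (\<lambda>p. D X Y p - D Y X p) = lie_bracket X Y)"

definition flat :: "connection \<Rightarrow> bool" where
  "flat D \<longleftrightarrow> (\<forall>X\<in>vector_fields. \<forall>Y\<in>vector_fields. \<forall>Z\<in>vector_fields. \<forall>p.
     D X (D Y Z) p - D Y (D X Z) p - D (lie_bracket X Y) Z p = 0)"

definition left_invariant :: "connection \<Rightarrow> bool" where
  "left_invariant D \<longleftrightarrow>
     (\<forall>g\<in>carrier Aff. \<forall>X\<in>vector_fields. \<forall>Y\<in>vector_fields.
        D (left_pushforward g X) (left_pushforward g Y) = left_pushforward g (D X Y))"

definition flat_left_invariant_affine_structure :: "connection \<Rightarrow> bool" where
  "flat_left_invariant_affine_structure D \<longleftrightarrow>
     linear_connection D \<and> flat D \<and> torsion_free D \<and> left_invariant D"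

text \<open>The product \<open>x \<cdot> y\<close> on the Lie algebra with \<open>(x \<cdot> y)\<^sup>+ = D\<^bsub>x\<^sup>+\<^esub> y\<^sup>+\<close>; it exists whenever \<open>D\<close> is a
  left invariant linear connection.\<close>

definition left_symmetric_product ::
    "connection \<Rightarrow> real \<times> real \<Rightarrow> real \<times> real \<Rightarrow> real \<times> real" where
  "left_symmetric_product D x y =
     (THE z. D (left_inv_field x) (left_inv_field y) = left_inv_field z)"

definition isomorphic_structures :: "connection \<Rightarrow> connection \<Rightarrow> bool" where
  "isomorphic_structures D D' \<longleftrightarrow>
     (\<exists>\<phi>. linear \<phi> \<and> bij \<phi> \<and>
        (\<forall>x y. \<phi> (left_symmetric_product D x y) = left_symmetric_product D' (\<phi> x) (\<phi> y)))"

section \<open>The bracket convention on the Lie algebra\<close>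

lemma left_translation_has_derivative:
  "(left_translation g has_derivative (\<lambda>v. fst g *\<^sub>R v)) (at q)"
proof -
  have "left_translation g = (\<lambda>h. fst g *\<^sub>R h + (0, snd g))"
    by (auto simp: left_translation_def Aff_def fun_eq_iff)
  then show ?thesis by (auto intro!: derivative_eq_intros)
qed

lemma left_inv_field_eq: "left_inv_field x = (\<lambda>p. fst p *\<^sub>R x)"
  by (auto simp: left_inv_field_def on_Aff_def fun_eq_iff Aff_def zero_prod_def
      simp flip: frechet_derivative_at[OF left_translation_has_derivative])

lemma lie_bracket_left_inv_field:
  "lie_bracket (left_inv_field (1, 0)) (left_inv_field (0, 1)) = left_inv_field (0, 1)"
proof -
  have "((\<lambda>p. fst p *\<^sub>R x) has_derivative (\<lambda>v. fst v *\<^sub>R x)) (at p)" for x p :: "real \<times> real"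
    by (auto intro!: derivative_eq_intros)
  note deriv = frechet_derivative_at[OF this, symmetric]
  show ?thesis
    unfolding lie_bracket_def left_inv_field_eq deriv
    by (simp add: on_Aff_def Aff_def fun_eq_iff zero_prod_def)
qed

end

theory Submission
  imports Defs
begin

text \<open>For each natural number \<open>n\<close>, the map \<open>(a, b) \<mapsto> (a ^ (n + 1) / (n + 1), b)\<close> is a local
  diffeomorphism from \<open>Aff\<close> to the plane. Left translation by \<open>(g, h)\<close> multiplies \<open>a ^ (n + 1)\<close> by
  \<open>g ^ (n + 1)\<close> and sends \<open>b\<close> to \<open>g b + h\<close>, so in these new coordinates it is affine. The standard
  connection of the plane therefore pulls back to a flat, torsion free, left invariant connection
  on \<open>Aff\<close> (\<open>chart_connection\<close>). Its left symmetric product on the Lie algebra is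
  \<open>(x\<^sub>1, x\<^sub>2) \<cdot> (y\<^sub>1, y\<^sub>2) = ((n + 1) x\<^sub>1 y\<^sub>1, x\<^sub>1 y\<^sub>2)\<close>
  (\<open>left_symmetric_product_chart_connection\<close>).

  The number \<open>n\<close> can be read off from the algebra. An isomorphism sends \<open>e\<^sub>2\<close> to a vector of square
  zero, hence to a multiple of \<open>e\<^sub>2\<close>; then \<open>e\<^sub>1 \<cdot> e\<^sub>2 = e\<^sub>2\<close> forces the image of \<open>e\<^sub>1\<close> to have first
  coordinate 1, and comparing the first coordinates of \<open>e\<^sub>1 \<cdot> e\<^sub>1 = (n + 1) e\<^sub>1\<close> determines \<open>n\<close>
  (\<open>isomorphic_chart_connections\<close>). Thus the connections are pairwise non-isomorphic.

  Two pieces of calculus underlie this. A connection must map smooth fields to smooth fields, which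
  needs closure properties of iterated differentiability; and flatness of the plane is the symmetry
  of second derivatives (\<open>second_derivative_symmetric\<close>).\<close>

section \<open>Smooth functions on open sets\<close>

lemma k_times_cont_diff_on_cong:
  assumes "open S" "\<And>p. p \<in> S \<Longrightarrow> f p = g p" "k_times_cont_diff_on k S f"
  shows "k_times_cont_diff_on k S g"
  using assms(2,3)
proof (induction k arbitrary: f g)
  case 0
  then show ?case by (simp cong: continuous_on_cong)
next
  case (Suc k)
  have diff: "g differentiable (at p)" if "p \<in> S" for p
    using Suc.prems that has_derivative_transform_within_open[OF _ \<open>open S\<close> that, of f _ UNIV g]
    unfolding differentiable_def k_times_cont_diff_on.simps by blast
  have "k_times_cont_diff_on k S (\<lambda>p. frechet_derivative g (at p) v)" for v
  proof (rule Suc.IH)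
    show "k_times_cont_diff_on k S (\<lambda>p. frechet_derivative f (at p) v)" using Suc.prems by simp
    show "frechet_derivative f (at p) v = frechet_derivative g (at p) v" if "p \<in> S" for p
      using frechet_derivative_transform_within_open[of f p S g] Suc.prems that \<open>open S\<close> by simp
  qed
  with diff show ?case by simp
qed

lemma k_times_cont_diff_on_SucI:
  assumes "open S" "\<And>p. p \<in> S \<Longrightarrow> (f has_derivative f' p) (at p)"
    and "\<And>v. k_times_cont_diff_on k S (\<lambda>p. f' p v)"
  shows "k_times_cont_diff_on (Suc k) S f"
proof -
  have "k_times_cont_diff_on k S (\<lambda>p. frechet_derivative f (at p) v)" for v
    by (rule k_times_cont_diff_on_cong[OF \<open>open S\<close> _ assms(3)[of v]])
      (use frechet_derivative_at[OF assms(2)] in metis)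
  then show ?thesis using assms(2) by (auto simp: differentiable_def)
qed

text \<open>The product rule for \<open>k + 1\<close> derivatives involves the undifferentiated factors, which are then
  needed as \<open>k\<close> times differentiable functions.\<close>

lemma k_times_cont_diff_on_SucD: "k_times_cont_diff_on (Suc k) S f \<Longrightarrow> k_times_cont_diff_on k S f"
proof (induction k arbitrary: f)
  case 0
  then show ?case
    by (auto intro!: differentiable_imp_continuous_on differentiable_at_imp_differentiable_on)
next
  case (Suc k)
  then show ?case by (metis k_times_cont_diff_on.simps(2))
qed

lemma k_times_cont_diff_on_has_derivative:
  "k_times_cont_diff_on (Suc k) S f \<Longrightarrow> p \<in> S \<Longrightarrow> (f has_derivative frechet_derivative f (at p)) (at p)"
  by (simp add: frechet_derivative_works)

lemma k_times_cont_diff_on_const: "k_times_cont_diff_on k S (\<lambda>p. c)"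
  by (induction k arbitrary: c) auto

lemma k_times_cont_diff_on_add:
  assumes "open S"
  shows "k_times_cont_diff_on k S f \<Longrightarrow> k_times_cont_diff_on k S g
    \<Longrightarrow> k_times_cont_diff_on k S (\<lambda>p. f p + g p)"
proof (induction k arbitrary: f g)
  case 0
  then show ?case by (simp add: continuous_on_add)
next
  case (Suc k)
  show ?case
    by (rule k_times_cont_diff_on_SucI[OF assms])
      (use Suc in \<open>auto intro!: has_derivative_add k_times_cont_diff_on_has_derivative
          simp del: k_times_cont_diff_on.simps(2), auto\<close>)
qed

lemma k_times_cont_diff_on_bounded_linear:
  assumes "open S" "bounded_linear T"
  shows "k_times_cont_diff_on k S f \<Longrightarrow> k_times_cont_diff_on k S (\<lambda>p. T (f p))"
proof (induction k arbitrary: f)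
  case 0
  then show ?case using assms(2) by (simp add: bounded_linear.continuous_on)
next
  case (Suc k)
  show ?case
    by (rule k_times_cont_diff_on_SucI[OF assms(1) bounded_linear.has_derivative[OF assms(2)]])
      (use Suc in \<open>auto intro!: k_times_cont_diff_on_has_derivative
          simp del: k_times_cont_diff_on.simps(2), auto\<close>)
qed

lemma k_times_cont_diff_on_bounded_bilinear:
  assumes "open S" "bounded_bilinear B"
  shows "k_times_cont_diff_on k S f \<Longrightarrow> k_times_cont_diff_on k S g
    \<Longrightarrow> k_times_cont_diff_on k S (\<lambda>p. B (f p) (g p))"
proof (induction k arbitrary: f g)
  case 0
  then show ?case using assms(2) by (simp add: bounded_bilinear.continuous_on)
next
  case (Suc k)
  note lower = Suc.prems[THEN k_times_cont_diff_on_SucD]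
  show ?case
  proof (rule k_times_cont_diff_on_SucI[OF assms(1) bounded_bilinear.FDERIV[OF assms(2)]])
    show "k_times_cont_diff_on k S (\<lambda>p. B (f p) (frechet_derivative g (at p) v)
        + B (frechet_derivative f (at p) v) (g p))" for v
      using Suc lower by (intro k_times_cont_diff_on_add[OF assms(1)] Suc.IH) auto
  qed (use Suc.prems in \<open>auto intro: k_times_cont_diff_on_has_derivative
          simp del: k_times_cont_diff_on.simps(2)\<close>)
qed

lemma k_times_cont_diff_on_inverse:
  fixes f :: "'a::euclidean_space \<Rightarrow> real"
  assumes "open S" "\<And>p. p \<in> S \<Longrightarrow> f p \<noteq> 0"
  shows "k_times_cont_diff_on k S f \<Longrightarrow> k_times_cont_diff_on k S (\<lambda>p. inverse (f p))"
proof (induction k)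
  case 0
  then show ?case using assms(2) by (auto intro!: continuous_on_inverse)
next
  case (Suc k)
  have inv: "k_times_cont_diff_on k S (\<lambda>p. inverse (f p))"
    using Suc k_times_cont_diff_on_SucD by blast
  show ?case
  proof (rule k_times_cont_diff_on_SucI[OF assms(1) Deriv.has_derivative_inverse])
    show "k_times_cont_diff_on k S
        (\<lambda>p. - (inverse (f p) * frechet_derivative f (at p) v * inverse (f p)))" for v
      using Suc.prems inv
      by (intro k_times_cont_diff_on_bounded_linear[OF assms(1), of uminus]
          k_times_cont_diff_on_bounded_bilinear[OF assms(1) bounded_bilinear_mult]
          bounded_linear_minus[OF bounded_linear_ident]) auto
  qed (use assms Suc.prems in \<open>auto intro: k_times_cont_diff_on_has_derivative
          simp del: k_times_cont_diff_on.simps(2)\<close>)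
qed

lemma smooth_on_has_derivative:
  "smooth_on S f \<Longrightarrow> p \<in> S \<Longrightarrow> (f has_derivative frechet_derivative f (at p)) (at p)"
  unfolding smooth_on_def using k_times_cont_diff_on_has_derivative by blast

lemma smooth_on_frechet_derivative:
  "smooth_on S f \<Longrightarrow> smooth_on S (\<lambda>p. frechet_derivative f (at p) v)"
  unfolding smooth_on_def by (metis k_times_cont_diff_on.simps(2))

lemma smooth_on_continuous_on: "smooth_on S f \<Longrightarrow> continuous_on S f"
  unfolding smooth_on_def by (metis k_times_cont_diff_on.simps(1))

lemma smooth_on_cong:
  "open S \<Longrightarrow> (\<And>p. p \<in> S \<Longrightarrow> f p = g p) \<Longrightarrow> smooth_on S f \<Longrightarrow> smooth_on S g"
  unfolding smooth_on_def using k_times_cont_diff_on_cong by blast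

lemma smooth_on_const: "smooth_on S (\<lambda>p. c)"
  by (simp add: smooth_on_def k_times_cont_diff_on_const)

lemma smooth_on_ident: "open S \<Longrightarrow> smooth_on S (\<lambda>p. p)"
  unfolding smooth_on_def
proof
  fix k assume "open S"
  then show "k_times_cont_diff_on k S (\<lambda>p. p)"
    by (cases k) (auto simp: k_times_cont_diff_on_const)
qed

lemma smooth_on_add:
  "open S \<Longrightarrow> smooth_on S f \<Longrightarrow> smooth_on S g \<Longrightarrow> smooth_on S (\<lambda>p. f p + g p)"
  by (simp add: smooth_on_def k_times_cont_diff_on_add)

lemma smooth_on_bounded_linear:
  "open S \<Longrightarrow> bounded_linear T \<Longrightarrow> smooth_on S f \<Longrightarrow> smooth_on S (\<lambda>p. T (f p))"
  by (simp add: smooth_on_def k_times_cont_diff_on_bounded_linear)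

lemma smooth_on_bounded_bilinear:
  "open S \<Longrightarrow> bounded_bilinear B \<Longrightarrow> smooth_on S f \<Longrightarrow> smooth_on S g
    \<Longrightarrow> smooth_on S (\<lambda>p. B (f p) (g p))"
  by (simp add: smooth_on_def k_times_cont_diff_on_bounded_bilinear)

lemma smooth_on_inverse:
  fixes f :: "'a::euclidean_space \<Rightarrow> real"
  shows "open S \<Longrightarrow> (\<And>p. p \<in> S \<Longrightarrow> f p \<noteq> 0) \<Longrightarrow> smooth_on S f
    \<Longrightarrow> smooth_on S (\<lambda>p. inverse (f p))"
  by (simp add: smooth_on_def k_times_cont_diff_on_inverse)

lemma smooth_on_power:
  fixes f :: "'a::euclidean_space \<Rightarrow> real"
  shows "open S \<Longrightarrow> smooth_on S f \<Longrightarrow> smooth_on S (\<lambda>p. f p ^ n)"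
  by (induction n)
    (auto intro: smooth_on_const smooth_on_bounded_bilinear[OF _ bounded_bilinear_mult])

lemma smooth_on_Pair:
  fixes f :: "'a::euclidean_space \<Rightarrow> 'b::real_normed_vector"
    and g :: "'a \<Rightarrow> 'c::real_normed_vector"
  assumes "open S" "smooth_on S f" "smooth_on S g"
  shows "smooth_on S (\<lambda>p. (f p, g p))"
proof -
  have "smooth_on S (\<lambda>p. (f p, 0::'c) + (0::'b, g p))"
    by (intro smooth_on_add smooth_on_bounded_linear[OF _ _ assms(2)]
        smooth_on_bounded_linear[OF _ _ assms(3)] assms(1)
        bounded_linear_Pair bounded_linear_ident bounded_linear_zero)
  then show ?thesis by simp
qed

lemma smooth_on_fst: "open S \<Longrightarrow> smooth_on S f \<Longrightarrow> smooth_on S (\<lambda>p. fst (f p))"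
  by (rule smooth_on_bounded_linear[OF _ bounded_linear_fst])

lemma smooth_on_snd: "open S \<Longrightarrow> smooth_on S f \<Longrightarrow> smooth_on S (\<lambda>p. snd (f p))"
  by (rule smooth_on_bounded_linear[OF _ bounded_linear_snd])

lemma linear_eq_sum_Basis:
  fixes T :: "'a::euclidean_space \<Rightarrow> 'b::real_vector"
  assumes "linear T"
  shows "T w = (\<Sum>b\<in>Basis. (w \<bullet> b) *\<^sub>R T b)"
proof -
  have "T (\<Sum>b\<in>Basis. (w \<bullet> b) *\<^sub>R b) = (\<Sum>b\<in>Basis. (w \<bullet> b) *\<^sub>R T b)"
    by (simp add: linear_sum[OF assms] linear_scale[OF assms])
  then show ?thesis by (simp add: euclidean_representation)
qed

lemma smooth_on_linear_frechet_derivative: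
  "smooth_on S f \<Longrightarrow> p \<in> S \<Longrightarrow> linear (frechet_derivative f (at p))"
  using smooth_on_has_derivative has_derivative_linear by blast

text \<open>\<^const>\<open>smooth_on\<close> only speaks of derivatives in constant directions. For a varying direction,
  expansion in the basis reduces to sums of products of these.\<close>

lemma smooth_on_frechet_derivative_along:
  assumes "open S" "smooth_on S f" "smooth_on S (X :: 'a::euclidean_space \<Rightarrow> 'a)"
  shows "smooth_on S (\<lambda>p. frechet_derivative f (at p) (X p))"
proof (rule smooth_on_cong[OF assms(1)])
  show "smooth_on S (\<lambda>p. \<Sum>b\<in>Basis. (X p \<bullet> b) *\<^sub>R frechet_derivative f (at p) b)"
  proof (induction rule: finite_induct[OF finite_Basis])
    case 1
    show ?case by (simp add: smooth_on_const)
  next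
    case (2 b F)
    then show ?case
      by (simp, intro smooth_on_add smooth_on_bounded_bilinear[OF _ bounded_bilinear_scaleR] assms(1)
          smooth_on_bounded_linear[OF _ bounded_linear_inner_left assms(3)]
          smooth_on_frechet_derivative assms(2))
  qed
  show "(\<Sum>b\<in>Basis. (X p \<bullet> b) *\<^sub>R frechet_derivative f (at p) b)
      = frechet_derivative f (at p) (X p)" if "p \<in> S" for p
    by (rule linear_eq_sum_Basis[OF smooth_on_linear_frechet_derivative[OF assms(2) that], symmetric])
qed

section \<open>Symmetry of second derivatives\<close>

lemma smooth_on_has_real_derivative_line:
  fixes g :: "'a::euclidean_space \<Rightarrow> real"
  assumes "smooth_on S g" "q + s *\<^sub>R w \<in> S"
  shows "((\<lambda>s. g (q + s *\<^sub>R w)) has_real_derivative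
    frechet_derivative g (at (q + s *\<^sub>R w)) w) (at s)"
proof -
  note g = smooth_on_has_derivative[OF assms]
  have "((\<lambda>s. q + s *\<^sub>R w) has_derivative (\<lambda>d. d *\<^sub>R w)) (at s)"
    by (auto intro!: derivative_eq_intros)
  from has_derivative_compose[OF this, of g] g
  have "((\<lambda>s. g (q + s *\<^sub>R w)) has_derivative
      (\<lambda>d. frechet_derivative g (at (q + s *\<^sub>R w)) (d *\<^sub>R w))) (at s)"
    by blast
  then show ?thesis
    using linear_scale[OF has_derivative_linear[OF g]]
    by (simp add: has_field_derivative_def mult.commute[of _ "frechet_derivative _ _ _"])
qed

text \<open>The left-hand side below is symmetric in \<open>u\<close> and \<open>v\<close>, which is what makes the mixed second
  derivatives agree in the limit. The mean value theorem is applied twice: first to the difference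
  of \<open>f\<close> along two parallel segments in direction \<open>u\<close>, then to the derivative in direction \<open>u\<close> along
  a segment in direction \<open>v\<close>.\<close>

lemma second_difference_mean_value:
  fixes f :: "'a::euclidean_space \<Rightarrow> real"
  assumes f: "smooth_on S f" and h: "0 < h"
    and box: "\<And>s t. 0 \<le> s \<Longrightarrow> s \<le> h \<Longrightarrow> 0 \<le> t \<Longrightarrow> t \<le> h \<Longrightarrow> p + s *\<^sub>R u + t *\<^sub>R v \<in> S"
  shows "\<exists>s t. 0 \<le> s \<and> s \<le> h \<and> 0 \<le> t \<and> t \<le> h \<and>
    f (p + h *\<^sub>R u + h *\<^sub>R v) - f (p + h *\<^sub>R u) - f (p + h *\<^sub>R v) + f p
      = h * h * frechet_derivative (\<lambda>q. frechet_derivative f (at q) u)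
                  (at (p + s *\<^sub>R u + t *\<^sub>R v)) v"
proof -
  have deriv_u: "((\<lambda>s. g (p + s *\<^sub>R u + t *\<^sub>R v)) has_real_derivative
      frechet_derivative g (at (p + s *\<^sub>R u + t *\<^sub>R v)) u) (at s)"
    if "smooth_on S g" "0 \<le> s" "s \<le> h" "0 \<le> t" "t \<le> h" for g :: "'a \<Rightarrow> real" and s t
  proof -
    have swap: "p + s *\<^sub>R u + t *\<^sub>R v = (p + t *\<^sub>R v) + s *\<^sub>R u" for s by simp
    show ?thesis
      using box[OF that(2-5)] unfolding swap by (rule smooth_on_has_real_derivative_line[OF that(1)])
  qed
  have deriv_v: "((\<lambda>t. g (p + s *\<^sub>R u + t *\<^sub>R v)) has_real_derivative
      frechet_derivative g (at (p + s *\<^sub>R u + t *\<^sub>R v)) v) (at t)"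
    if "smooth_on S g" "0 \<le> s" "s \<le> h" "0 \<le> t" "t \<le> h" for g :: "'a \<Rightarrow> real" and s t
    by (rule smooth_on_has_real_derivative_line[OF that(1) box[OF that(2-5)]])
  define \<phi> where "\<phi> = (\<lambda>s. f (p + s *\<^sub>R u + h *\<^sub>R v) - f (p + s *\<^sub>R u + 0 *\<^sub>R v))"
  have "\<exists>s>0. s < h \<and> \<phi> h - \<phi> 0 = (h - 0) *
      (frechet_derivative f (at (p + s *\<^sub>R u + h *\<^sub>R v)) u
        - frechet_derivative f (at (p + s *\<^sub>R u + 0 *\<^sub>R v)) u)"
    unfolding \<phi>_def
    by (rule MVT2[OF h]) (use h in \<open>intro DERIV_diff deriv_u[OF f]; simp\<close>)
  then obtain s where s: "0 < s" "s < h" "\<phi> h - \<phi> 0 = h *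
      (frechet_derivative f (at (p + s *\<^sub>R u + h *\<^sub>R v)) u
        - frechet_derivative f (at (p + s *\<^sub>R u + 0 *\<^sub>R v)) u)"
    by auto
  have "\<exists>t>0. t < h \<and> frechet_derivative f (at (p + s *\<^sub>R u + h *\<^sub>R v)) u
      - frechet_derivative f (at (p + s *\<^sub>R u + 0 *\<^sub>R v)) u
      = (h - 0) * frechet_derivative (\<lambda>q. frechet_derivative f (at q) u)
                    (at (p + s *\<^sub>R u + t *\<^sub>R v)) v"
    by (rule MVT2[OF h]) (use s in \<open>intro deriv_v smooth_on_frechet_derivative f; simp\<close>)
  then obtain t where "0 < t" "t < h" "\<phi> h - \<phi> 0 = h * (h *
      frechet_derivative (\<lambda>q. frechet_derivative f (at q) u) (at (p + s *\<^sub>R u + t *\<^sub>R v)) v)"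
    using s(3) by auto
  with s(1,2) show ?thesis
    by (intro exI[of _ s] exI[of _ t]) (simp add: \<phi>_def)
qed

text \<open>If the two mixed derivatives differed at \<open>p\<close>, then by continuity each would stay within half
  of that difference on a small ball. But the second difference of a small parallelogram equals
  both a value of the one and a value of the other, up to the same factor.\<close>

lemma second_derivative_symmetric_real:
  fixes f :: "'a::euclidean_space \<Rightarrow> real"
  assumes "open S" and f: "smooth_on S f" and p: "p \<in> S"
  shows "frechet_derivative (\<lambda>q. frechet_derivative f (at q) u) (at p) v
       = frechet_derivative (\<lambda>q. frechet_derivative f (at q) v) (at p) u" (is "?A p = ?B p")
proof (rule ccontr)
  assume neq: "?A p \<noteq> ?B p"
  have cont: "isCont ?A p" "isCont ?B p"
    using smooth_on_continuous_on[OF smooth_on_frechet_derivative[OF smooth_on_frechet_derivative[OF f]]]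
      continuous_on_eq_continuous_at[OF \<open>open S\<close>] p by auto
  have pos: "dist (?A p) (?B p) / 2 > 0" using neq by simp
  obtain r1 where r1: "r1 > 0" "ball p r1 \<subseteq> S" using \<open>open S\<close> p openE by blast
  obtain r2 where r2: "r2 > 0" "\<And>q. dist q p < r2 \<Longrightarrow> dist (?A q) (?A p) < dist (?A p) (?B p) / 2"
    using cont(1) pos unfolding continuous_at_eps_delta by (metis)
  obtain r3 where r3: "r3 > 0" "\<And>q. dist q p < r3 \<Longrightarrow> dist (?B q) (?B p) < dist (?A p) (?B p) / 2"
    using cont(2) pos unfolding continuous_at_eps_delta by (metis)
  define r where "r = min r1 (min r2 r3)"
  define h where "h = r / (norm u + norm v + 1)"
  have r: "r > 0" using r1 r2 r3 by (simp add: r_def)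
  have den: "norm u + norm v + 1 > 0"
    by (smt (verit) norm_ge_zero)
  have h: "h > 0" using r den by (simp add: h_def)
  have near: "dist (p + s *\<^sub>R x + t *\<^sub>R y) p < r"
    if "0 \<le> s" "s \<le> h" "0 \<le> t" "t \<le> h" "norm x + norm y = norm u + norm v" for s t x y
  proof -
    have "norm (s *\<^sub>R x + t *\<^sub>R y) \<le> s * norm x + t * norm y"
      using norm_triangle_ineq[of "s *\<^sub>R x" "t *\<^sub>R y"] that by simp
    also have "\<dots> \<le> h * norm x + h * norm y"
      using that by (intro add_mono mult_right_mono) auto
    also have "\<dots> = h * (norm u + norm v)" using that(5) by (metis distrib_left)
    also have "\<dots> < h * (norm u + norm v + 1)" using h by simp
    also have "\<dots> = r" using den by (simp add: h_def)
    finally show ?thesis by (simp add: dist_norm add.assoc)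
  qed
  have in_S: "p + s *\<^sub>R x + t *\<^sub>R y \<in> S"
    if "0 \<le> s" "s \<le> h" "0 \<le> t" "t \<le> h" "norm x + norm y = norm u + norm v" for s t x y
    using near[OF that] r1(2) by (auto simp: r_def dist_commute)
  obtain s t where st: "0 \<le> s" "s \<le> h" "0 \<le> t" "t \<le> h"
      "f (p + h *\<^sub>R u + h *\<^sub>R v) - f (p + h *\<^sub>R u) - f (p + h *\<^sub>R v) + f p
        = h * h * ?A (p + s *\<^sub>R u + t *\<^sub>R v)"
    using second_difference_mean_value[OF f h, of p u v] in_S[of _ _ u v] by auto
  obtain s' t' where st': "0 \<le> s'" "s' \<le> h" "0 \<le> t'" "t' \<le> h"
      "f (p + h *\<^sub>R v + h *\<^sub>R u) - f (p + h *\<^sub>R v) - f (p + h *\<^sub>R u) + f p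
        = h * h * ?B (p + s' *\<^sub>R v + t' *\<^sub>R u)"
    using second_difference_mean_value[OF f h, of p v u] in_S[of _ _ v u] by auto
  have "h * h * ?A (p + s *\<^sub>R u + t *\<^sub>R v) = h * h * ?B (p + s' *\<^sub>R v + t' *\<^sub>R u)"
    unfolding st(5)[symmetric] st'(5)[symmetric] by (simp add: add_ac)
  then have "?A (p + s *\<^sub>R u + t *\<^sub>R v) = ?B (p + s' *\<^sub>R v + t' *\<^sub>R u)" using h by simp
  moreover have "dist (?A (p + s *\<^sub>R u + t *\<^sub>R v)) (?A p) < dist (?A p) (?B p) / 2"
    using near[OF st(1-4), of u v] by (intro r2) (simp add: r_def)
  moreover have "dist (?B (p + s' *\<^sub>R v + t' *\<^sub>R u)) (?B p) < dist (?A p) (?B p) / 2"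
    using near[OF st'(1-4), of v u] by (intro r3) (simp add: r_def)
  ultimately show False
    by (smt (verit, best) dist_real_def field_sum_of_halves)
qed

lemma second_derivative_symmetric:
  fixes f :: "'a::euclidean_space \<Rightarrow> 'b::euclidean_space"
  assumes "open S" and f: "smooth_on S f" and p: "p \<in> S"
  shows "frechet_derivative (\<lambda>q. frechet_derivative f (at q) u) (at p) v
       = frechet_derivative (\<lambda>q. frechet_derivative f (at q) v) (at p) u"
proof (rule euclidean_eqI)
  fix b :: 'b
  have inner: "frechet_derivative (\<lambda>q. g q \<bullet> b) (at q) x = frechet_derivative g (at q) x \<bullet> b"
    if "smooth_on S g" "q \<in> S" for g :: "'a \<Rightarrow> 'b" and q x
    by (rule fun_cong[OF frechet_derivative_at[symmetric]])
      (rule has_derivative_inner_left[OF smooth_on_has_derivative[OF that]])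
  have second: "frechet_derivative (\<lambda>q. frechet_derivative (\<lambda>q. f q \<bullet> b) (at q) x) (at p) y
      = frechet_derivative (\<lambda>q. frechet_derivative f (at q) x) (at p) y \<bullet> b" for x y
  proof -
    note g = smooth_on_frechet_derivative[OF f, of x]
    have "((\<lambda>q. frechet_derivative (\<lambda>q. f q \<bullet> b) (at q) x) has_derivative
        (\<lambda>y. frechet_derivative (\<lambda>q. frechet_derivative f (at q) x) (at p) y \<bullet> b)) (at p)"
      by (rule has_derivative_transform_within_open[OF
            has_derivative_inner_left[OF smooth_on_has_derivative[OF g p]] \<open>open S\<close> p])
        (simp add: inner[OF f])
    from frechet_derivative_at[OF this] show ?thesis by metis
  qed
  show "frechet_derivative (\<lambda>q. frechet_derivative f (at q) u) (at p) v \<bullet> b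
       = frechet_derivative (\<lambda>q. frechet_derivative f (at q) v) (at p) u \<bullet> b"
    using second_derivative_symmetric_real[OF assms(1)
        smooth_on_bounded_linear[OF assms(1) bounded_linear_inner_left f, of b] p, of u v]
    by (simp add: second)
qed

section \<open>A family of connections\<close>

lemma carrier_Aff: "p \<in> carrier Aff \<longleftrightarrow> fst p \<noteq> 0"
  by (simp add: Aff_def)

lemma open_carrier_Aff: "open (carrier Aff)"
proof -
  have "carrier Aff = fst -` (- {0::real})" by (auto simp: carrier_Aff)
  then show ?thesis by (auto intro: open_vimage_fst)
qed

lemma in_vector_fields_iff:
  "X \<in> vector_fields \<longleftrightarrow>
    smooth_on (carrier Aff) X \<and> (\<forall>p. p \<notin> carrier Aff \<longrightarrow> X p = 0)"
  by (simp add: vector_fields_def)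

lemma on_Aff_in_vector_fields:
  "smooth_on (carrier Aff) X \<Longrightarrow> on_Aff X \<in> vector_fields"
  using smooth_on_cong[OF open_carrier_Aff, of X "on_Aff X"]
  by (simp add: in_vector_fields_iff on_Aff_def)

text \<open>With \<open>c = a ^ n\<close> this is the differential of the chart \<open>(a, b) \<mapsto> (a ^ (n + 1) / (n + 1), b)\<close> at
  the point \<open>(a, b)\<close>, and with the inverse of \<open>c\<close> it is the inverse of that differential.\<close>

definition stretch :: "real \<Rightarrow> real \<times> real \<Rightarrow> real \<times> real" where
  "stretch c v = (c * fst v, snd v)"

lemma stretch_stretch [simp]: "stretch c (stretch d v) = stretch (c * d) v"
  by (simp add: stretch_def)

lemma stretch_one [simp]: "stretch 1 v = v"
  by (simp add: stretch_def)

lemma bounded_linear_stretch: "bounded_linear (stretch c)"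
  unfolding stretch_def
  by (intro bounded_linear_Pair bounded_linear_const_mult bounded_linear_fst bounded_linear_snd)

lemmas linear_stretch = bounded_linear.linear[OF bounded_linear_stretch]

lemma stretch_add: "stretch c (v + w) = stretch c v + stretch c w"
  by (rule linear_add[OF linear_stretch])

lemma stretch_diff: "stretch c (v - w) = stretch c v - stretch c w"
  by (rule linear_diff[OF linear_stretch])

lemma smooth_on_stretch:
  assumes "open S" "smooth_on S f" "smooth_on S X"
  shows "smooth_on S (\<lambda>q. stretch (f q) (X q))"
  unfolding stretch_def
  by (intro smooth_on_Pair smooth_on_bounded_bilinear[OF _ bounded_bilinear_mult]
      smooth_on_fst smooth_on_snd assms)

lemma stretch_has_derivative:
  assumes "(f has_derivative f') (at p)" "(Y has_derivative Y') (at p)"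
  shows "((\<lambda>q. stretch (f q) (Y q)) has_derivative
    (\<lambda>v. (f' v * fst (Y p), 0) + stretch (f p) (Y' v))) (at p)"
  unfolding stretch_def
  by (rule derivative_eq_intros assms refl)+ (simp add: fun_eq_iff)

text \<open>A vector field is parallel for the pulled back connection iff its components in the chart are
  locally constant. So the connection differentiates these components and transports the result
  back to a tangent vector of \<open>Aff\<close>.\<close>

definition chart_field :: "nat \<Rightarrow> vfield \<Rightarrow> vfield" where
  "chart_field n Y = (\<lambda>q. stretch (fst q ^ n) (Y q))"

definition chart_connection :: "nat \<Rightarrow> connection" where
  "chart_connection n X Y = on_Aff (\<lambda>p.
     stretch (inverse (fst p ^ n)) (frechet_derivative (chart_field n Y) (at p) (X p)))"

lemma smooth_on_chart_field:
  "smooth_on (carrier Aff) Y \<Longrightarrow> smooth_on (carrier Aff) (chart_field n Y)"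
  unfolding chart_field_def
  by (intro smooth_on_stretch smooth_on_power smooth_on_fst smooth_on_ident open_carrier_Aff)

lemma chart_field_has_derivative:
  assumes "(Y has_derivative Y') (at p)"
  shows "(chart_field n Y has_derivative
    (\<lambda>v. (real n * fst p ^ (n - 1) * fst v * fst (Y p), 0) + stretch (fst p ^ n) (Y' v))) (at p)"
proof -
  have "((\<lambda>q. fst q ^ n) has_derivative (\<lambda>v. real n * fst p ^ (n - 1) * fst v)) (at p)"
    by (auto intro!: derivative_eq_intros simp: mult_ac)
  from stretch_has_derivative[OF this assms] show ?thesis
    unfolding chart_field_def .
qed

lemma chart_connection_in_vector_fields:
  assumes "X \<in> vector_fields" "Y \<in> vector_fields"
  shows "chart_connection n X Y \<in> vector_fields"
  unfolding chart_connection_def using assms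
  by (intro on_Aff_in_vector_fields smooth_on_stretch open_carrier_Aff smooth_on_inverse
      smooth_on_power smooth_on_fst smooth_on_ident smooth_on_frechet_derivative_along
      smooth_on_chart_field) (auto simp: in_vector_fields_iff carrier_Aff)

text \<open>In the coordinates \<open>(a, b)\<close> the only Christoffel symbol that can be nonzero is \<open>n / a\<close>, the
  logarithmic derivative of the factor \<open>a ^ n\<close>. Being symmetric, it does not contribute to the
  torsion.\<close>

lemma chart_connection_Christoffel:
  assumes p: "p \<in> carrier Aff" and Y: "(Y has_derivative Y') (at p)"
  shows "chart_connection n X Y p =
    Y' (X p) + (real n * fst (X p) * fst (Y p) / fst p, 0)"
proof -
  have "chart_connection n X Y p = stretch (inverse (fst p ^ n))
    ((real n * fst p ^ (n - 1) * fst (X p) * fst (Y p), 0) + stretch (fst p ^ n) (Y' (X p)))"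
    using p frechet_derivative_at[OF chart_field_has_derivative[OF Y, of n], symmetric]
    by (simp add: chart_connection_def on_Aff_def)
  moreover have "inverse (fst p ^ n) * (real n * fst p ^ (n - 1)) = real n / fst p"
    using p by (cases n) (auto simp: carrier_Aff field_simps)
  ultimately show ?thesis
    using p unfolding stretch_add stretch_stretch
    by (simp add: carrier_Aff stretch_def[of _ "(_, _)"] mult.assoc[symmetric])
qed

lemma vector_field_has_derivative:
  "Y \<in> vector_fields \<Longrightarrow> p \<in> carrier Aff \<Longrightarrow> (Y has_derivative frechet_derivative Y (at p)) (at p)"
  unfolding in_vector_fields_iff using smooth_on_has_derivative by blast

lemma chart_connection_outside [simp]: "p \<notin> carrier Aff \<Longrightarrow> chart_connection n X Y p = 0"
  by (simp add: chart_connection_def on_Aff_def)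

lemma linear_connection_chart_connection: "linear_connection (chart_connection n)"
  unfolding linear_connection_def
proof (intro conjI ballI allI impI)
  fix X Y assume X: "X \<in> vector_fields" and Y: "Y \<in> vector_fields"
  show "chart_connection n X Y \<in> vector_fields"
    by (rule chart_connection_in_vector_fields[OF X Y])
  show "chart_connection n (\<lambda>p. X p + X' p) Y
      = (\<lambda>p. chart_connection n X Y p + chart_connection n X' Y p)" if "X' \<in> vector_fields" for X'
  proof
    fix p
    show "chart_connection n (\<lambda>p. X p + X' p) Y p
      = chart_connection n X Y p + chart_connection n X' Y p"
    proof (cases "p \<in> carrier Aff")
      case True
      note d = vector_field_has_derivative[OF Y True]
      show ?thesis
        by (simp add: chart_connection_Christoffel[OF True d] linear_add[OF has_derivative_linear[OF d]]
            field_simps add_divide_distrib)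
    qed simp
  qed
  show "chart_connection n X (\<lambda>p. Y p + Y' p)
      = (\<lambda>p. chart_connection n X Y p + chart_connection n X Y' p)" if Y': "Y' \<in> vector_fields" for Y'
  proof
    fix p
    show "chart_connection n X (\<lambda>p. Y p + Y' p) p
      = chart_connection n X Y p + chart_connection n X Y' p"
    proof (cases "p \<in> carrier Aff")
      case True
      note d = vector_field_has_derivative[OF Y True] vector_field_has_derivative[OF Y' True]
      show ?thesis
        by (simp add: chart_connection_Christoffel[OF True d(1)] chart_connection_Christoffel[OF True d(2)]
            chart_connection_Christoffel[OF True has_derivative_add[OF d]]
            ring_distribs add_divide_distrib)
    qed simp
  qed
next
  fix f :: "real \<times> real \<Rightarrow> real" and X Y
  assume f: "smooth_on (carrier Aff) f" and X: "X \<in> vector_fields" and Y: "Y \<in> vector_fields"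
  show "chart_connection n (\<lambda>p. f p *\<^sub>R X p) Y = (\<lambda>p. f p *\<^sub>R chart_connection n X Y p)"
  proof
    fix p
    show "chart_connection n (\<lambda>p. f p *\<^sub>R X p) Y p = f p *\<^sub>R chart_connection n X Y p"
    proof (cases "p \<in> carrier Aff")
      case True
      note d = vector_field_has_derivative[OF Y True]
      show ?thesis
        by (simp add: chart_connection_Christoffel[OF True d] linear_scale[OF has_derivative_linear[OF d]]
            scaleR_add_right)
    qed simp
  qed
  show "chart_connection n X (\<lambda>p. f p *\<^sub>R Y p)
      = (\<lambda>p. directional_deriv X f p *\<^sub>R Y p + f p *\<^sub>R chart_connection n X Y p)"
  proof
    fix p
    show "chart_connection n X (\<lambda>p. f p *\<^sub>R Y p) p
      = directional_deriv X f p *\<^sub>R Y p + f p *\<^sub>R chart_connection n X Y p"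
    proof (cases "p \<in> carrier Aff")
      case True
      note d = vector_field_has_derivative[OF Y True]
      show ?thesis
        by (simp add: chart_connection_Christoffel[OF True d] directional_deriv_def
            chart_connection_Christoffel[OF True
              has_derivative_scaleR[OF smooth_on_has_derivative[OF f True] d]]
            scaleR_add_right)
    next
      case False
      then have "Y p = 0" using Y unfolding in_vector_fields_iff by blast
      with False show ?thesis by simp
    qed
  qed
qed

lemma torsion_free_chart_connection: "torsion_free (chart_connection n)"
  unfolding torsion_free_def
proof (intro ballI ext)
  fix X Y p assume X: "X \<in> vector_fields" and Y: "Y \<in> vector_fields"
  show "chart_connection n X Y p - chart_connection n Y X p = lie_bracket X Y p"
  proof (cases "p \<in> carrier Aff")
    case True
    show ?thesis
      using True
      by (simp add: chart_connection_Christoffel[OF True vector_field_has_derivative[OF X True]]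
          chart_connection_Christoffel[OF True vector_field_has_derivative[OF Y True]]
          lie_bracket_def on_Aff_def mult_ac)
  qed (simp add: lie_bracket_def on_Aff_def)
qed

section \<open>Flatness\<close>

lemma frechet_derivative_derivative_along:
  assumes "open S" "smooth_on S f" "smooth_on S (X :: 'a::euclidean_space \<Rightarrow> 'a)" "p \<in> S"
  shows "frechet_derivative (\<lambda>q. frechet_derivative f (at q) (X q)) (at p) v
    = frechet_derivative (\<lambda>q. frechet_derivative f (at q) (X p)) (at p) v
      + frechet_derivative f (at p) (frechet_derivative X (at p) v)"
proof -
  have expand: "frechet_derivative f (at q) w = (\<Sum>b\<in>Basis. (w \<bullet> b) *\<^sub>R frechet_derivative f (at q) b)"
    if "q \<in> S" for q w
    by (rule linear_eq_sum_Basis[OF smooth_on_linear_frechet_derivative[OF assms(2) that]])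
  have deriv: "frechet_derivative (\<lambda>q. frechet_derivative f (at q) (Z q)) (at p) v
      = (\<Sum>b\<in>Basis. (Z p \<bullet> b) *\<^sub>R frechet_derivative (\<lambda>q. frechet_derivative f (at q) b) (at p) v)
        + frechet_derivative f (at p) (Z' v)"
    if Z: "(Z has_derivative Z') (at p)" for Z :: "'a \<Rightarrow> 'a" and Z'
  proof -
    have "((\<lambda>q. \<Sum>b\<in>Basis. (Z q \<bullet> b) *\<^sub>R frechet_derivative f (at q) b) has_derivative
      (\<lambda>v. \<Sum>b\<in>Basis. (Z p \<bullet> b) *\<^sub>R frechet_derivative (\<lambda>q. frechet_derivative f (at q) b) (at p) v
            + (Z' v \<bullet> b) *\<^sub>R frechet_derivative f (at p) b)) (at p)"
      by (intro has_derivative_sum has_derivative_scaleR has_derivative_inner_left Z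
          smooth_on_has_derivative[OF smooth_on_frechet_derivative[OF assms(2)] assms(4)])
    then have "((\<lambda>q. frechet_derivative f (at q) (Z q)) has_derivative
      (\<lambda>v. (\<Sum>b\<in>Basis. (Z p \<bullet> b) *\<^sub>R frechet_derivative (\<lambda>q. frechet_derivative f (at q) b) (at p) v)
            + frechet_derivative f (at p) (Z' v))) (at p)"
      unfolding sum.distrib expand[OF assms(4), symmetric]
      by (rule has_derivative_transform_within_open[OF _ assms(1,4)]) (metis expand)
    from frechet_derivative_at[OF this, symmetric] show ?thesis by (rule fun_cong)
  qed
  show ?thesis
    using deriv[OF smooth_on_has_derivative[OF assms(3,4)]] deriv[OF has_derivative_const[of "X p"]]
      linear_0[OF smooth_on_linear_frechet_derivative[OF assms(2,4)]]
    by simp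
qed

text \<open>In the chart, differentiating twice gives \<open>X (Y W)\<close> for the vector \<open>W\<close> of components of \<open>Z\<close>. The
  terms that differentiate \<open>X\<close> and \<open>Y\<close> make up the derivative of \<open>W\<close> along the bracket, and
  the remaining second derivatives of \<open>W\<close> cancel by symmetry.\<close>

lemma flat_chart_connection: "flat (chart_connection n)"
  unfolding flat_def
proof (intro ballI allI)
  fix X Y Z p assume X: "X \<in> vector_fields" and Y: "Y \<in> vector_fields" and Z: "Z \<in> vector_fields"
  show "chart_connection n X (chart_connection n Y Z) p
      - chart_connection n Y (chart_connection n X Z) p - chart_connection n (lie_bracket X Y) Z p = 0"
  proof (cases "p \<in> carrier Aff")
    case True
    define W where "W = chart_field n Z"
    have W: "smooth_on (carrier Aff) W"
      using Z by (simp add: W_def smooth_on_chart_field in_vector_fields_iff)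
    have lin: "linear (frechet_derivative W (at p))"
      by (rule smooth_on_linear_frechet_derivative[OF W True])
    have nabla: "chart_connection n U (chart_connection n V Z) p = stretch (inverse (fst p ^ n))
        (frechet_derivative (\<lambda>q. frechet_derivative W (at q) (V p)) (at p) (U p)
          + frechet_derivative W (at p) (frechet_derivative V (at p) (U p)))"
      if V: "V \<in> vector_fields" for U V
    proof -
      have V': "smooth_on (carrier Aff) V" using V by (simp add: in_vector_fields_iff)
      have "chart_field n (chart_connection n V Z) q = frechet_derivative W (at q) (V q)"
        if "q \<in> carrier Aff" for q
        unfolding chart_field_def[of n "chart_connection n V Z"] using that
        by (simp add: W_def chart_connection_def on_Aff_def carrier_Aff)
      then have "frechet_derivative (chart_field n (chart_connection n V Z)) (at p)
          = frechet_derivative (\<lambda>q. frechet_derivative W (at q) (V q)) (at p)"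
        by (intro frechet_derivative_at[symmetric] has_derivative_transform_within_open[OF
              smooth_on_has_derivative[OF smooth_on_frechet_derivative_along[OF open_carrier_Aff W V'] True]
              open_carrier_Aff True]) simp
      then have "chart_connection n U (chart_connection n V Z) p = stretch (inverse (fst p ^ n))
          (frechet_derivative (\<lambda>q. frechet_derivative W (at q) (V q)) (at p) (U p))"
        unfolding chart_connection_def[of n U] on_Aff_def using True by (simp only: if_True)
      then show ?thesis
        unfolding frechet_derivative_derivative_along[OF open_carrier_Aff W V' True] .
    qed
    have bracket: "chart_connection n (lie_bracket X Y) Z p = stretch (inverse (fst p ^ n))
        (frechet_derivative W (at p)
          (frechet_derivative Y (at p) (X p) - frechet_derivative X (at p) (Y p)))"
      using True by (simp add: chart_connection_def lie_bracket_def on_Aff_def W_def)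
    show ?thesis
      unfolding nabla[OF X] nabla[OF Y] bracket
      unfolding stretch_add stretch_diff linear_diff[OF lin]
        second_derivative_symmetric[OF open_carrier_Aff W True, of "Y p" "X p"]
      by (simp only: algebra_simps add_0_left)
  qed simp
qed

section \<open>Left invariance\<close>

lemma left_translation_inverse:
  assumes "g \<in> carrier Aff" and "h = inv\<^bsub>Aff\<^esub> g"
  shows "fst h * fst g = 1" "p \<in> carrier Aff \<Longrightarrow> left_translation h p \<in> carrier Aff"
    "fst (left_translation h p) = fst h * fst p"
proof -
  interpret group Aff by (rule group_Aff)
  have "h \<otimes>\<^bsub>Aff\<^esub> g = \<one>\<^bsub>Aff\<^esub>" using assms by simp
  then show "fst h * fst g = 1" by (simp add: Aff_def)
  show "p \<in> carrier Aff \<Longrightarrow> left_translation h p \<in> carrier Aff"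
    using assms by (simp add: left_translation_def)
  show "fst (left_translation h p) = fst h * fst p"
    by (simp add: left_translation_def Aff_def)
qed

lemma left_pushforward_eq:
  "left_pushforward g X = on_Aff (\<lambda>p. fst g *\<^sub>R X (left_translation (inv\<^bsub>Aff\<^esub> g) p))"
  by (simp add: left_pushforward_def Let_def left_translation_def[of "inv\<^bsub>Aff\<^esub> g"]
      flip: frechet_derivative_at[OF left_translation_has_derivative])

text \<open>A left translation is an affine map with linear part multiplication by \<open>g\<^sub>1\<close>. It commutes with
  differentiation of components, and it preserves the term with the Christoffel symbol \<open>n / a\<close>, as
  this is homogeneous of degree \<open>-1\<close> in \<open>a\<close>.\<close>

lemma left_invariant_chart_connection: "left_invariant (chart_connection n)"
  unfolding left_invariant_def
proof (intro ballI ext)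
  fix g X Y p
  assume g: "g \<in> carrier Aff" and X: "X \<in> vector_fields" and Y: "Y \<in> vector_fields"
  define h where "h = inv\<^bsub>Aff\<^esub> g"
  note L = left_translation_inverse[OF g h_def]
  note push = left_pushforward_eq[of g, folded h_def]
  show "chart_connection n (left_pushforward g X) (left_pushforward g Y) p
      = left_pushforward g (chart_connection n X Y) p"
  proof (cases "p \<in> carrier Aff")
    case True
    define q where "q = left_translation h p"
    have q: "q \<in> carrier Aff" using L(2) True by (simp add: q_def)
    have Lp: "fst p = fst g * fst q"
      using L(1) L(3)[of p] by (simp add: q_def mult.assoc[symmetric] mult.commute)
    note d = vector_field_has_derivative[OF Y q]
    have "((\<lambda>r. fst g *\<^sub>R Y (left_translation h r)) has_derivative
        (\<lambda>v. fst g *\<^sub>R frechet_derivative Y (at q) (fst h *\<^sub>R v))) (at p)"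
      using has_derivative_compose[OF left_translation_has_derivative[of h p], of Y] d
      by (intro has_derivative_scaleR_right) (simp add: q_def)
    then have d': "(left_pushforward g Y has_derivative
        (\<lambda>v. fst g *\<^sub>R frechet_derivative Y (at q) (fst h *\<^sub>R v))) (at p)"
      by (rule has_derivative_transform_within_open[OF _ open_carrier_Aff True])
        (simp add: push on_Aff_def)
    show ?thesis
      using True g L(1) q
      by (simp add: chart_connection_Christoffel[OF True d'])
        (simp add: push on_Aff_def chart_connection_Christoffel[OF q d] Lp
          q_def[symmetric] scaleR_add_right carrier_Aff)
  qed (simp add: push on_Aff_def)
qed

section \<open>The associated left symmetric algebras\<close>

lemma left_symmetric_product_chart_connection:
  "left_symmetric_product (chart_connection n) x y = ((real n + 1) * fst x * fst y, fst x * snd y)"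
proof -
  let ?z = "((real n + 1) * fst x * fst y, fst x * snd y)"
  have eq: "chart_connection n (left_inv_field x) (left_inv_field y) = left_inv_field ?z"
  proof
    fix p
    show "chart_connection n (left_inv_field x) (left_inv_field y) p = left_inv_field ?z p"
    proof (cases "p \<in> carrier Aff")
      case True
      have "(left_inv_field y has_derivative (\<lambda>v. fst v *\<^sub>R y)) (at p)"
        unfolding left_inv_field_eq by (auto intro!: derivative_eq_intros)
      from chart_connection_Christoffel[OF True this] True show ?thesis
        by (simp add: left_inv_field_eq carrier_Aff prod_eq_iff field_simps)
    qed (simp add: left_inv_field_eq carrier_Aff zero_prod_def)
  qed
  have "z = z'" if "left_inv_field z = left_inv_field z'" for z z'
    using fun_cong[OF that, of "(1, 0)"] by (simp add: left_inv_field_eq)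
  then show ?thesis unfolding left_symmetric_product_def eq by blast
qed

lemma isomorphic_chart_connections:
  assumes "isomorphic_structures (chart_connection m) (chart_connection n)"
  shows "m = n"
proof -
  obtain \<phi> where lin: "linear \<phi>" and "bij \<phi>" and
    hom: "\<And>x y. \<phi> ((real m + 1) * fst x * fst y, fst x * snd y)
      = ((real n + 1) * fst (\<phi> x) * fst (\<phi> y), fst (\<phi> x) * snd (\<phi> y))"
    using assms unfolding isomorphic_structures_def left_symmetric_product_chart_connection by auto
  have inj: "\<phi> v = 0 \<Longrightarrow> v = 0" for v
    using bij_is_inj[OF \<open>bij \<phi>\<close>] linear_0[OF lin] by (metis injD)
  define a b c d where "a = fst (\<phi> (1, 0))" and "b = snd (\<phi> (1, 0))"
    and "c = fst (\<phi> (0, 1))" and "d = snd (\<phi> (0, 1))"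
  have \<phi>1: "\<phi> (1, 0) = (a, b)" and \<phi>2: "\<phi> (0, 1) = (c, d)"
    by (simp_all add: a_def b_def c_def d_def)
  have "\<phi> (0, 0) = 0" using linear_0[OF lin] by (simp add: zero_prod_def)
  \<comment> \<open>the square of \<open>e\<^sub>2\<close> vanishes, and \<open>n + 1\<close> is not zero\<close>
  with hom[of "(0, 1)" "(0, 1)"] have "c = 0" by (simp add: \<phi>2 zero_prod_def)
  with inj[of "(0, 1)"] have "d \<noteq> 0" by (auto simp: \<phi>2 zero_prod_def)
  with hom[of "(1, 0)" "(0, 1)"] have "a = 1" by (simp add: \<phi>1 \<phi>2)
  moreover have "\<phi> (real m + 1, 0) = ((real m + 1) * a, (real m + 1) * b)"
    using linear_scale[OF lin, of "real m + 1" "(1, 0)"] by (simp add: \<phi>1)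
  ultimately show "m = n" using hom[of "(1, 0)" "(1, 0)"] by (simp add: \<phi>1)
qed

theorem mainTheorem11:
  "\<exists>S :: connection set. infinite S \<and>
     (\<forall>D\<in>S. flat_left_invariant_affine_structure D) \<and>
     pairwise (\<lambda>D D'. \<not> isomorphic_structures D D') S"
proof (intro exI conjI ballI)
  have "isomorphic_structures D D" for D
    unfolding isomorphic_structures_def by (rule exI[of _ id]) (simp add: linear_id)
  then have "inj chart_connection"
    by (metis injI isomorphic_chart_connections)
  then show "infinite (range chart_connection)"
    by (rule range_inj_infinite)
  show "flat_left_invariant_affine_structure D" if "D \<in> range chart_connection" for D
    using that by (auto simp: flat_left_invariant_affine_structure_def flat_chart_connection
        linear_connection_chart_connection torsion_free_chart_connection left_invariant_chart_connection)
  show "pairwise (\<lambda>D D'. \<not> isomorphic_structures D D') (range chart_connection)"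
    unfolding pairwise_def using isomorphic_chart_connections by blast
qed

end
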